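(* Let $N_1,N_2\ge 1$ and $N_3\ge 0$ be integers. For every $\rho^0\in(0,1/2]$ and every $c\in(0,1)$, the stationary problem $\mathcal P(N_1,N_2,N_3,\rho^0,c)$ (defined in the context) has a positive decreasing solution; that is, there exist real numbers $\rho^{(1)}_0,\dots,\rho^{(1)}_{N_1}$, $\rho^{(2)}_0,\dots,\rho^{(2)}_{N_2+N_3}$, $R_0,\dots,R_{N_2+N_3}$, $j^{(1)}$, $j^{(2)}_0,\dots,j^{(2)}_{N_2+N_3-1}$, $J^{(2)}$ satisfying all equations of $\mathcal P(N_1,N_2,N_3,\rho^0,c)$, with $$\rho_0^{(1)},\ldots,\rho_{N_1}^{(1)},\ \rho_0^{(2)},\ldots,\rho_{N_2+N_3-1}^{(2)},\ R_0,\ldots,R_{N_2-1},\ j^{(1)},\ j^{(2)}_0,\ldots,j^{(2)}_{N_2+N_3-1},\ J^{(2)}>0$$ and $$\rho^{(1)}_0>\cdots>\rho^{(1)}_{N_1}>\rho^{(2)}_0>\cdots>\rho^{(2)}_{N_2+N_3}=0,\qquad R_0>\cdots>R_{N_2}=0.$$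
   Context: The problem describes stationary densities of two kinds of particles (scanning and elongating ribosomes) along a one-dimensional array. Definition (stationary problem $\mathcal P(N_1,N_2,N_3,\rho^0,c)$). The unknowns are real numbers $\rho^{(1)}_0,\dots,\rho^{(1)}_{N_1}$; $\rho^{(2)}_0,\dots,\rho^{(2)}_{N_2+N_3}$; $R_0,\dots,R_{N_2+N_3}$; $j^{(1)}$; $j^{(2)}_0,\dots,j^{(2)}_{N_2+N_3-1}$; $J^{(2)}$. The equations are: (i) $\rho_{n+1}^{(1)}=1-\dfrac{j^{(1)}}{\rho_n^{(1)}}$ for $n=0,\ldots,N_1-1$; (ii) $R_{m+1}=1-\dfrac{J^{(2)}}{R_m}$ for $m=0,\ldots,N_2-1$, and $R_{m+1}=R_m$ for $m=N_2,\ldots,N_2+N_3-1$; (iii) $\rho_{m+1}^{(2)}=1-\dfrac{j_m^{(2)}}{\rho_m^{(2)}}$ for $m=0,\ldots,N_2+N_3-1$; (iv) $j_{m+1}^{(2)}=j_m^{(2)}-R_{m+1}\rho_m^{(2)}-(R_m-R_{m+2})\rho_{m+1}^{(2)}$ for $m=0,\ldots,N_2+N_3-2$; (v) boundary and matching conditions: $\rho_0^{(1)}=\rho^0$; $R_0=c\,\rho_{N_1}^{(1)}$; $\rho_0^{(2)}=(1-c)\rho_{N_1}^{(1)}$; $j^{(1)}=j_0^{(2)}+J^{(2)}-\rho_0^{(2)}R_1$; $R_{N_2}=0$; $\rho_{N_2+N_3}^{(2)}=0$. All denominators appearing in (i)–(iii) are required to be nonzero. *)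

theory Defs
  imports Complex_Main
begin

text \<open>
  Finite families are represented by functions on the naturals; only the values at the indices
  occurring in the equations are constrained. The names \<open>\<rho>1\<close>, \<open>\<rho>2\<close>, \<open>j1\<close>, \<open>j2\<close>, \<open>J2\<close> stand for
  the quantities with superscripts (1) and (2). The index range \<open>m = 0, \<dots>, N2 + N3 - 2\<close> is
  written \<open>m + 2 \<le> N2 + N3\<close>, so that it is empty when \<open>N2 + N3 = 1\<close>.
\<close>

definition stationary_solution ::
  "nat \<Rightarrow> nat \<Rightarrow> nat \<Rightarrow> real \<Rightarrow> real \<Rightarrow>
   (nat \<Rightarrow> real) \<Rightarrow> (nat \<Rightarrow> real) \<Rightarrow> (nat \<Rightarrow> real) \<Rightarrow> real \<Rightarrow> (nat \<Rightarrow> real) \<Rightarrow> real \<Rightarrow> bool"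
where
  "stationary_solution N1 N2 N3 \<rho>0 c \<rho>1 \<rho>2 R j1 j2 J2 \<longleftrightarrow>
    (\<forall>n<N1. \<rho>1 n \<noteq> 0 \<and> \<rho>1 (n + 1) = 1 - j1 / \<rho>1 n) \<and>
    (\<forall>m<N2. R m \<noteq> 0 \<and> R (m + 1) = 1 - J2 / R m) \<and>
    (\<forall>m. N2 \<le> m \<and> m < N2 + N3 \<longrightarrow> R (m + 1) = R m) \<and>
    (\<forall>m<N2 + N3. \<rho>2 m \<noteq> 0 \<and> \<rho>2 (m + 1) = 1 - j2 m / \<rho>2 m) \<and>
    (\<forall>m. m + 2 \<le> N2 + N3 \<longrightarrow>
      j2 (m + 1) = j2 m - R (m + 1) * \<rho>2 m - (R m - R (m + 2)) * \<rho>2 (m + 1)) \<and>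
    \<rho>1 0 = \<rho>0 \<and>
    R 0 = c * \<rho>1 N1 \<and>
    \<rho>2 0 = (1 - c) * \<rho>1 N1 \<and>
    j1 = j2 0 + J2 - \<rho>2 0 * R 1 \<and>
    R N2 = 0 \<and>
    \<rho>2 (N2 + N3) = 0"

end

theory Submission
  imports Defs "HOL-Analysis.Brouwer_Fixpoint"
begin

text \<open>
  Read backwards from the end of the array, every recursion of the problem becomes explicit: all
  densities are determined by the two numbers \<open>J2\<close> and \<open>a = \<rho>2 (N2 + N3 - 1)\<close>, and positivity and
  monotonicity propagate from each index to the preceding one. Two equations remain for
  \<open>(J2, a)\<close>: the splitting ratio \<open>R 0 : \<rho>2 0 = c : (1 - c)\<close> and \<open>\<rho>1 0 = \<rho>0\<close>. In the
  coordinates \<open>J2 = s t\<close>, \<open>a = s (1 - t)\<close> on the unit square, they satisfy the sign conditions of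
  the Poincare-Miranda theorem. The backward recursions are truncated at the density \<open>1 / 2\<close> to
  make them globally continuous; since densities increase backwards and \<open>\<rho>0 \<le> 1 / 2\<close>, the
  truncations are inactive on the solution.
\<close>

text \<open>Brouwer's theorem for \<open>h\<close>, which moves a point by minus
  \<open>(F, G)\<close> and clips the result to the square. At a fixed point an unclipped coordinate
  has zero displacement; on a side, the boundary sign rules out a displacement hidden by
  clipping.\<close>

lemma poincare_miranda_square:
  fixes F G :: "real \<times> real \<Rightarrow> real"
  assumes "continuous_on ({0..1} \<times> {0..1}) F" "continuous_on ({0..1} \<times> {0..1}) G"
    and F: "\<And>t. t \<in> {0..1} \<Longrightarrow> F (0, t) \<le> 0" "\<And>t. t \<in> {0..1} \<Longrightarrow> 0 \<le> F (1, t)"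
    and G: "\<And>s. s \<in> {0..1} \<Longrightarrow> G (s, 0) \<le> 0" "\<And>s. s \<in> {0..1} \<Longrightarrow> 0 \<le> G (s, 1)"
  obtains s t where "s \<in> {0..1}" "t \<in> {0..1}" "F (s, t) = 0" "G (s, t) = 0"
proof -
  define clip :: "real \<Rightarrow> real" where "clip = (\<lambda>x. max 0 (min 1 x))"
  define h where "h = (\<lambda>z. (clip (fst z - F z), clip (snd z - G z)))"
  let ?Q = "{0..1::real} \<times> {0..1::real}"
  have "continuous_on ?Q h"
    unfolding h_def clip_def by (intro continuous_intros assms)
  moreover have "compact ?Q" "convex ?Q" "?Q \<noteq> {}"
    by (auto intro!: compact_Times convex_Times)
  moreover have "h \<in> ?Q \<rightarrow> ?Q"
    by (auto simp: h_def clip_def)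
  ultimately obtain z where z: "z \<in> ?Q" "h z = z"
    using brouwer by metis
  obtain s t where st: "z = (s, t)" by force
  have s: "s \<in> {0..1}" and t: "t \<in> {0..1}"
    using z st by auto
  have clip_fixed: "y = 0"
    if "clip (x - y) = x" "x \<in> {0..1}" "x = 0 \<Longrightarrow> y \<le> 0" "x = 1 \<Longrightarrow> 0 \<le> y" for x y
    using that by (auto simp: clip_def max_def min_def split: if_splits)
  have "F (s, t) = 0"
    by (rule clip_fixed[of s]) (use z st s t F in \<open>auto simp: h_def\<close>)
  moreover have "G (s, t) = 0"
    by (rule clip_fixed[of t]) (use z st s t G in \<open>auto simp: h_def\<close>)
  ultimately show thesis using s t that by blast
qed

text \<open>
  In the three backward recursions the index counts the distance to the end: \<open>scan_back N3 J k\<close>,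
  \<open>elong_back N3 J a k\<close> and \<open>init_back w x k\<close> stand for \<open>R (N2 + N3 - k)\<close>, \<open>\<rho>2 (N2 + N3 - k)\<close> and
  \<open>\<rho>1 (N1 - k)\<close>. Eliminating \<open>j2\<close> from (iii) and (iv) gives the recursion for \<open>\<rho>2\<close>.
\<close>

fun scan_back :: "nat \<Rightarrow> real \<Rightarrow> nat \<Rightarrow> real" where
  "scan_back d J 0 = 0"
| "scan_back d J (Suc k) = (if k < d then 0 else J / (1 - min (scan_back d J k) (1/2)))"

declare scan_back.simps(2) [simp del]

text \<open>\<open>p0, q0\<close> belong to site \<open>m + 2\<close>, \<open>p1, q1\<close> to
  \<open>m + 1\<close> and \<open>q2\<close> to \<open>m\<close>. The \<open>max\<close> keeps the
  denominator positive and is inactive once \<open>p1 + q1 \<le> 1/2\<close>.\<close>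

definition elong_ratio :: "real \<Rightarrow> real \<Rightarrow> real \<Rightarrow> real \<Rightarrow> real \<Rightarrow> real" where
  "elong_ratio p0 p1 q0 q1 q2 = (1 - min p0 (1/2) + q2 - q0) / max (1/2) (1 - p1 - q1)"

fun elong_back :: "nat \<Rightarrow> real \<Rightarrow> real \<Rightarrow> nat \<Rightarrow> real" where
  "elong_back d J a 0 = 0"
| "elong_back d J a (Suc 0) = a"
| "elong_back d J a (Suc (Suc k)) =
    elong_back d J a (Suc k)
      * elong_ratio (elong_back d J a k) (elong_back d J a (Suc k))
          (scan_back d J k) (scan_back d J (Suc k)) (scan_back d J (Suc (Suc k)))"

declare elong_back.simps(3) [simp del]

fun init_back :: "real \<Rightarrow> real \<Rightarrow> nat \<Rightarrow> real" where
  "init_back w x 0 = x"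
| "init_back w x (Suc k) = max (init_back w x k) (w / (1 - min (init_back w x k) (1/2)))"

section \<open>Continuity in the parameters\<close>

lemma one_minus_min_pos: "0 < 1 - min x (1/2 :: real)"
  by auto

lemma continuous_on_scan_back [continuous_intros]:
  assumes "continuous_on S J"
  shows "continuous_on S (\<lambda>z. scan_back d (J z) k)"
proof (induction k)
  case (Suc k)
  show ?case
  proof (cases "k < d")
    case False
    have "1 - min (scan_back d (J z) k) (1/2) \<noteq> 0" for z
      using one_minus_min_pos[of "scan_back d (J z) k"] by linarith
    with False show ?thesis
      by (auto simp: scan_back.simps(2) intro!: continuous_intros assms Suc)
  qed (simp add: scan_back.simps(2))
qed auto

lemma continuous_on_elong_back [continuous_intros]:
  assumes "continuous_on S J" "continuous_on S a"
  shows "continuous_on S (\<lambda>z. elong_back d (J z) (a z) k)"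
proof (induction k rule: induct_nat_012)
  case (ge2 k)
  have nz: "max (1/2) x \<noteq> 0" for x :: real
    by linarith
  show ?case
    unfolding elong_back.simps elong_ratio_def
    by (intro continuous_intros assms ge2 ballI) (rule nz)
qed (use assms in auto)

lemma continuous_on_init_back [continuous_intros]:
  assumes "continuous_on S w" "continuous_on S x"
  shows "continuous_on S (\<lambda>z. init_back (w z) (x z) k)"
proof (induction k)
  case (Suc k)
  have nz: "1 - min y (1/2) \<noteq> 0" for y :: real
    using one_minus_min_pos[of y] by linarith
  show ?case
    unfolding init_back.simps by (intro continuous_intros assms Suc ballI) (rule nz)
qed (use assms in auto)

section \<open>Monotonicity of the scanning densities \<open>R\<close>\<close>

lemma scan_back_nonneg:
  assumes "0 \<le> J"
  shows "0 \<le> scan_back d J k"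
  by (cases k) (auto simp: scan_back.simps(2) intro!: divide_nonneg_pos assms)

lemma scan_back_eq_0: "k \<le> d \<Longrightarrow> scan_back d J k = 0"
  by (cases k) (auto simp: scan_back.simps(2))

lemma scan_back_J_0: "scan_back d 0 k = 0"
  by (cases k) (auto simp: scan_back.simps(2))

text \<open>Truncation leaves \<open>J / (1 - min x (1/2))\<close> nondecreasing in
  \<open>x\<close>, so an increase passes on to the next index.\<close>

lemma scan_back_mono_Suc:
  assumes "0 \<le> J"
  shows "scan_back d J k \<le> scan_back d J (Suc k)"
proof (induction k)
  case 0
  show ?case using scan_back_nonneg[OF assms] by simp
next
  case (Suc k)
  show ?case
  proof (cases "k < d")
    case True
    then show ?thesis
      using scan_back_nonneg[OF assms, of d "Suc (Suc k)"] by (simp add: scan_back_eq_0)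
  next
    case False
    have "J / (1 - min (scan_back d J k) (1/2)) \<le> J / (1 - min (scan_back d J (Suc k)) (1/2))"
      by (rule divide_left_mono[OF _ assms])
        (use Suc one_minus_min_pos in \<open>auto intro!: mult_pos_pos\<close>)
    then show ?thesis using False by (simp add: scan_back.simps(2))
  qed
qed

lemma scan_back_mono: "0 \<le> J \<Longrightarrow> k \<le> l \<Longrightarrow> scan_back d J k \<le> scan_back d J l"
  by (rule lift_Suc_mono_le[of "scan_back d J"]) (rule scan_back_mono_Suc)

text \<open>The value at \<open>d + 1\<close> is exactly \<open>J\<close>, because its predecessor
  is 0.\<close>

lemma scan_back_ge:
  assumes "0 \<le> J" "d < k"
  shows "J \<le> scan_back d J k"
proof -
  have "J = scan_back d J (Suc d)"
    by (simp add: scan_back.simps(2) scan_back_eq_0)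
  also have "\<dots> \<le> scan_back d J k"
    using assms by (intro scan_back_mono) auto
  finally show ?thesis .
qed

text \<open>By monotonicity the bound at \<open>Suc k\<close> reaches all smaller indices, where the
  truncation then drops out; the first rise, from 0 to \<open>J\<close>, is strict, and
  \<open>J / (1 - x)\<close> preserves strictness.\<close>

lemma scan_back_strict:
  assumes "0 < J" "d \<le> k" "scan_back d J (Suc k) \<le> 1/2"
  shows "scan_back d J k < scan_back d J (Suc k)"
  using assms(2,3)
proof (induction k rule: dec_induct)
  case base
  then show ?case using assms(1) by (simp add: scan_back.simps(2) scan_back_eq_0)
next
  case (step k)
  let ?q = "scan_back d J"
  have le: "?q (Suc k) \<le> 1/2" "?q k \<le> 1/2"
    using step.prems scan_back_mono_Suc[of J d "Suc k"] scan_back_mono_Suc[of J d k] assms(1)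
    by linarith+
  with step.IH have "?q k < ?q (Suc k)" by simp
  with le have "J / (1 - ?q k) < J / (1 - ?q (Suc k))"
    by (intro divide_strict_left_mono assms(1) mult_pos_pos) linarith+
  moreover have "?q (Suc k) = J / (1 - ?q k)" "?q (Suc (Suc k)) = J / (1 - ?q (Suc k))"
    using step.hyps le by (simp_all add: scan_back.simps(2) min_def)
  ultimately show ?case by simp
qed

section \<open>Monotonicity of the elongating densities \<open>\<rho>2\<close>\<close>

lemma elong_back_a_0: "elong_back d J 0 k = 0"
  by (induction k rule: induct_nat_012) (auto simp: elong_back.simps(3))

text \<open>The factor \<open>num / den\<close> is at least 1: \<open>num\<close> is at least 1/2
  since \<open>?q\<close> increases, and at least \<open>1 - ?p (Suc k) - ?q (Suc k)\<close> by
  induction.\<close>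

lemma elong_back_mono_Suc_nonneg:
  assumes "0 \<le> J" "0 \<le> a"
  shows "0 \<le> elong_back d J a k \<and> elong_back d J a k \<le> elong_back d J a (Suc k)"
proof (induction k)
  case 0
  show ?case using assms by simp
next
  case (Suc k)
  let ?p = "elong_back d J a" and ?q = "scan_back d J"
  define num where "num = 1 - min (?p k) (1/2) + ?q (Suc (Suc k)) - ?q k"
  define den where "den = max (1/2) (1 - ?p (Suc k) - ?q (Suc k))"
  have "?q k \<le> ?q (Suc (Suc k))" "0 \<le> ?q (Suc k)"
    using assms by (auto intro: scan_back_mono scan_back_nonneg)
  with Suc have "den \<le> num" "0 < den"
    unfolding num_def den_def by linarith+
  moreover have "?p (Suc (Suc k)) = ?p (Suc k) * (num / den)"
    unfolding num_def den_def elong_back.simps(3) elong_ratio_def ..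
  moreover have "0 \<le> ?p (Suc k)" using Suc by linarith
  ultimately show ?case
    using mult_left_mono[of 1 "num / den" "?p (Suc k)"] by simp
qed

lemma elong_back_nonneg: "0 \<le> J \<Longrightarrow> 0 \<le> a \<Longrightarrow> 0 \<le> elong_back d J a k"
  using elong_back_mono_Suc_nonneg by blast

lemma elong_back_mono: "0 \<le> J \<Longrightarrow> 0 \<le> a \<Longrightarrow> k \<le> l \<Longrightarrow> elong_back d J a k \<le> elong_back d J a l"
  by (rule lift_Suc_mono_le[of "elong_back d J a"])
    (use elong_back_mono_Suc_nonneg in blast)

lemma elong_back_ge:
  assumes "0 \<le> J" "0 \<le> a" "0 < k"
  shows "a \<le> elong_back d J a k"
  using elong_back_mono[OF assms(1,2), of 1 k d] assms(3) by simp

text \<open>The bound concerns the sum because the denominator is 1 minus that sum. It descends to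
  smaller indices and removes both truncations; strict growth at one index then makes the next
  factor exceed 1.\<close>

lemma elong_back_strict:
  assumes "0 \<le> J" "0 < a" "elong_back d J a (Suc k) + scan_back d J (Suc k) \<le> 1/2"
  shows "elong_back d J a k < elong_back d J a (Suc k)"
  using assms(3)
proof (induction k)
  case 0
  show ?case using assms by simp
next
  case (Suc k)
  let ?p = "elong_back d J a" and ?q = "scan_back d J"
  have p_mono: "?p k \<le> ?p (Suc k)" "?p (Suc k) \<le> ?p (Suc (Suc k))" "a \<le> ?p (Suc k)"
    using assms by (auto intro!: elong_back_mono elong_back_ge)
  have q_mono: "?q k \<le> ?q (Suc k)" "?q (Suc k) \<le> ?q (Suc (Suc k))" "0 \<le> ?q (Suc k)"
    using assms scan_back_mono_Suc scan_back_nonneg by blast+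
  define num where "num = 1 - ?p k + ?q (Suc (Suc k)) - ?q k"
  define den where "den = 1 - ?p (Suc k) - ?q (Suc k)"
  have "?p k < ?p (Suc k)"
    using Suc p_mono q_mono by linarith
  then have "den < num" "1/2 \<le> den" "?p k \<le> 1/2"
    using Suc.prems p_mono q_mono unfolding num_def den_def by linarith+
  moreover from this have "num = 1 - min (?p k) (1/2) + ?q (Suc (Suc k)) - ?q k"
    "den = max (1/2) (1 - ?p (Suc k) - ?q (Suc k))"
    unfolding num_def den_def by linarith+
  then have "?p (Suc (Suc k)) = ?p (Suc k) * (num / den)"
    by (simp only: elong_back.simps(3) elong_ratio_def)
  moreover have "0 < ?p (Suc k)" using p_mono assms by linarith
  ultimately show ?case
    using mult_strict_left_mono[of 1 "num / den" "?p (Suc k)"] by simp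
qed

section \<open>Densities \<open>\<rho>1\<close> before the split\<close>

text \<open>The outer \<open>max\<close> in \<open>init_back\<close> secures this for all
  \<open>w\<close> and \<open>x\<close>, so it is available before the truncations are known to be
  inactive.\<close>

lemma init_back_mono: "k \<le> l \<Longrightarrow> init_back w x k \<le> init_back w x l"
  by (rule lift_Suc_mono_le) auto

lemma init_back_0_0: "init_back 0 0 k = 0"
  by (induction k) auto

text \<open>The inequality \<open>y * (1 - y) < w\<close> is an invariant: it makes
  \<open>z = w / (1 - y)\<close> larger than \<open>y\<close>, so \<open>max\<close> selects it, and
  then \<open>z * (1 - z) < z * (1 - y) = w\<close>.\<close>

lemma init_back_step:
  assumes "x * (1 - x) < w" "0 < x" "init_back w x (Suc k) \<le> 1/2"
  shows "init_back w x k < init_back w x (Suc k)"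
    and "init_back w x (Suc k) * (1 - init_back w x k) = w"
proof -
  let ?y = "init_back w x"
  have le: "?y i \<le> 1/2" if "i \<le> Suc k" for i
    using init_back_mono[OF that, of w x] assms(3) by linarith
  have pos: "0 < ?y i" for i
    using init_back_mono[of 0 i w x] assms(2) by simp
  have main: "?y i * (1 - ?y i) < w" if "i \<le> k" for i
    using that
  proof (induction i)
    case 0
    show ?case using assms by simp
  next
    case (Suc i)
    have yi: "?y i \<le> 1/2" using le Suc.prems by simp
    with Suc have *: "?y i < w / (1 - ?y i)"
      by (simp add: less_divide_eq)
    with yi have eq: "?y (Suc i) = w / (1 - ?y i)"
      by (simp add: min_def max_def)
    have "?y (Suc i) * (1 - ?y (Suc i)) < ?y (Suc i) * (1 - ?y i)"
      using * eq pos[of "Suc i"] by (intro mult_strict_left_mono) linarith+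
    also have "\<dots> = w" using eq yi by simp
    finally show ?case .
  qed
  have yk: "?y k \<le> 1/2" using le by simp
  with main[of k] have *: "?y k < w / (1 - ?y k)"
    by (simp add: less_divide_eq)
  with yk have eq: "?y (Suc k) = w / (1 - ?y k)"
    by (simp add: min_def max_def)
  show "?y k < ?y (Suc k)" using * eq by simp
  show "?y (Suc k) * (1 - ?y k) = w" using eq yk by simp
qed

theorem theorem3p1:
  fixes N1 N2 N3 :: nat and \<rho>0 c :: real
  assumes "N1 \<ge> 1" and "N2 \<ge> 1"
    and "0 < \<rho>0" and "\<rho>0 \<le> 1 / 2"
    and "0 < c" and "c < 1"
  shows "\<exists>(\<rho>1 :: nat \<Rightarrow> real) (\<rho>2 :: nat \<Rightarrow> real) (R :: nat \<Rightarrow> real)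
            (j1 :: real) (j2 :: nat \<Rightarrow> real) (J2 :: real).
    stationary_solution N1 N2 N3 \<rho>0 c \<rho>1 \<rho>2 R j1 j2 J2 \<and>
    (\<forall>n\<le>N1. \<rho>1 n > 0) \<and>
    (\<forall>m<N2 + N3. \<rho>2 m > 0) \<and>
    (\<forall>m<N2. R m > 0) \<and>
    j1 > 0 \<and>
    (\<forall>m<N2 + N3. j2 m > 0) \<and>
    J2 > 0 \<and>
    (\<forall>n<N1. \<rho>1 n > \<rho>1 (n + 1)) \<and>
    \<rho>1 N1 > \<rho>2 0 \<and>
    (\<forall>m<N2 + N3. \<rho>2 m > \<rho>2 (m + 1)) \<and>
    \<rho>2 (N2 + N3) = 0 \<and>
    (\<forall>m<N2. R m > R (m + 1)) \<and>
    R N2 = 0"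
proof -

  \<comment> \<open>Two equations on the unit square\<close>
  define M where "M = N2 + N3"
  have M: "N3 < M" "1 \<le> M" using assms by (auto simp: M_def)
  define q where "q = scan_back N3"
  define p where "p = elong_back N3"
  \<comment> \<open>The matching condition for \<open>j1\<close>: index \<open>M\<close> is site 0,
    index \<open>M - 1\<close> is site 1.\<close>
  define w where "w = (\<lambda>J a. p J a M * (1 - p J a (M - 1)) + J - p J a M * q J (M - 1))"
  \<comment> \<open>The conditions on \<open>R 0\<close> and \<open>\<rho>2 0\<close> add up to
    \<open>\<rho>1 N1 = R 0 + \<rho>2 0\<close>, the start of this recursion; \<open>G\<close>
    encodes their ratio.\<close>
  define y where "y = (\<lambda>J a. init_back (w J a) (p J a M + q J M))"
  define F where "F = (\<lambda>(s, t). y (s * t) (s * (1 - t)) N1 - \<rho>0)"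
  define G where "G = (\<lambda>(s, t). (1 - c) * q (s * t) M - c * p (s * t) (s * (1 - t)) M)"
  let ?Q = "{0..1::real} \<times> {0..1::real}"
  have "continuous_on ?Q F" "continuous_on ?Q G"
    unfolding F_def G_def y_def w_def p_def q_def case_prod_beta by (intro continuous_intros)+
  \<comment> \<open>On \<open>s = 0\<close> all densities vanish; on \<open>s = 1\<close> the start
    value is at least \<open>J2 + a = 1\<close>.\<close>
  moreover have "F (0, t) \<le> 0" if "t \<in> {0..1}" for t
    using assms M
    by (simp add: F_def y_def w_def p_def q_def elong_back_a_0 scan_back_J_0 init_back_0_0)
  moreover have "0 \<le> F (1, t)" if t: "t \<in> {0..1}" for t
  proof -
    have "t + (1 - t) \<le> q t M + p t (1 - t) M"
      unfolding p_def q_def using t M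
      by (intro add_mono scan_back_ge elong_back_ge) auto
    then show ?thesis
      using init_back_mono[of 0 N1 "w t (1 - t)" "p t (1 - t) M + q t M"] assms
      by (simp add: F_def y_def)
  qed
  moreover have "G (s, 0) \<le> 0" if "s \<in> {0..1}" for s
    using that assms by (simp add: G_def p_def q_def scan_back_J_0 elong_back_nonneg)
  moreover have "0 \<le> G (s, 1)" if "s \<in> {0..1}" for s
    using that assms by (simp add: G_def p_def q_def elong_back_a_0 scan_back_nonneg)
  ultimately obtain s t where st: "s \<in> {0..1}" "t \<in> {0..1}" and "F (s, t) = 0" "G (s, t) = 0"
    by (rule poincare_miranda_square)
  define J where "J = s * t"
  define a where "a = s * (1 - t)"
  have yN: "y J a N1 = \<rho>0" and split: "(1 - c) * q J M = c * p J a M"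
    using \<open>F (s, t) = 0\<close> \<open>G (s, t) = 0\<close> by (auto simp: F_def G_def J_def a_def)
  have nonneg: "0 \<le> J" "0 \<le> a" using st by (auto simp: J_def a_def)
  have JqM: "J \<le> q J M" and apM: "a \<le> p J a M"
    unfolding q_def p_def using nonneg M by (auto intro: scan_back_ge elong_back_ge)
  \<comment> \<open>If both vanished, \<open>y\<close> would be 0 instead of \<open>\<rho>0\<close>;
    by \<open>split\<close>, if one vanishes so does the other.\<close>
  have "\<not> (J = 0 \<and> a = 0)"
    using yN assms M
    by (auto simp: y_def w_def p_def q_def elong_back_a_0 scan_back_J_0 init_back_0_0)
  moreover have "J = 0 \<longrightarrow> a = 0"
    using split apM nonneg assms by (auto simp: q_def scan_back_J_0)
  moreover have "a = 0 \<longrightarrow> J = 0"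
    using split JqM nonneg assms by (auto simp: p_def elong_back_a_0)
  ultimately have J: "0 < J" and a: "0 < a" using nonneg by force+

  \<comment> \<open>Removal of the truncations\<close>
  define Y where "Y = y J a"
  define P where "P = p J a"
  define Q where "Q = q J"
  define W where "W = w J a"
  have Y_mono: "Y k \<le> Y l" if "k \<le> l" for k l
    using that by (auto simp: Y_def y_def init_back_mono)
  have Y0: "Y 0 = P M + Q M" and YN: "Y N1 = \<rho>0"
    using yN by (auto simp: Y_def P_def Q_def y_def)
  \<comment> \<open>Every sum is bounded by \<open>Y 0 \<le> Y N1 = \<rho>0 \<le> 1/2\<close>. There
    is no circularity: the monotonicity used holds for the truncated recursions.\<close>
  have PQ_le: "P k + Q k \<le> 1/2" if "k \<le> M" for k
  proof -
    have "P k + Q k \<le> P M + Q M"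
      unfolding P_def Q_def p_def q_def using nonneg that
      by (intro add_mono elong_back_mono scan_back_mono)
    also have "\<dots> \<le> 1/2" using Y_mono[of 0 N1] Y0 YN assms by simp
    finally show ?thesis .
  qed
  have P_nonneg: "0 \<le> P k" and Q_nonneg: "0 \<le> Q k" for k
    unfolding P_def Q_def p_def q_def using nonneg by (auto intro: elong_back_nonneg scan_back_nonneg)
  have P_le: "P k \<le> 1/2" and Q_le: "Q k \<le> 1/2" if "k \<le> M" for k
    using PQ_le[OF that] P_nonneg[of k] Q_nonneg[of k] by linarith+
  have P_strict: "P k < P (Suc k)" if "k < M" for k
    using elong_back_strict[of J a N3 k] PQ_le[of "Suc k"] that nonneg a
    by (simp add: P_def Q_def p_def q_def)
  have Q_strict: "Q k < Q (Suc k)" if "N3 \<le> k" "k < M" for k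
    using scan_back_strict[of J N3 k] Q_le[of "Suc k"] that J by (simp add: Q_def q_def)
  have Q_rec: "Q (Suc k) * (1 - Q k) = J" if "N3 \<le> k" "k < M" for k
    using that Q_le[of k] by (simp add: Q_def q_def scan_back.simps(2) min_def)
  have Q_0: "Q k = 0" if "k \<le> N3" for k
    using that by (simp add: Q_def q_def scan_back_eq_0)
  have P_rec: "P (Suc (Suc k)) * (1 - P (Suc k) - Q (Suc k))
      = P (Suc k) * (1 - P k + Q (Suc (Suc k)) - Q k)" if "Suc (Suc k) \<le> M" for k
  proof -
    let ?den = "1 - P (Suc k) - Q (Suc k)"
    have den: "1/2 \<le> ?den" using PQ_le[of "Suc k"] that by linarith
    then have "min (P k) (1/2) = P k" "max (1/2) ?den = ?den"
      using P_le[of k] that by linarith+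
    then have "P (Suc (Suc k)) = P (Suc k) * ((1 - P k + Q (Suc (Suc k)) - Q k) / ?den)"
      unfolding P_def Q_def p_def q_def by (simp only: elong_back.simps(3) elong_ratio_def)
    with den show ?thesis by simp
  qed
  obtain M' where M': "M = Suc M'" using M by (cases M) auto
  have QJ: "Q M * (1 - Q M') = J" using Q_rec[of M'] M M' by simp
  have W_eq: "W = P M * (1 - P M') + J - P M * Q M'"
    by (simp add: W_def w_def M' P_def Q_def)
  have PQ_strict: "P M' < P M" "Q M' < Q M" "0 < P M" "0 < Q M"
    using P_strict[of M'] Q_strict[of M'] M M' P_nonneg[of M'] Q_nonneg[of M'] by auto
  \<comment> \<open>The invariant of \<open>init_back_step\<close> at the junction. With
    \<open>J = Q M * (1 - Q M')\<close>, \<open>W\<close> splits into two terms, each larger than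
    its counterpart here.\<close>
  have "Y 0 * (1 - Y 0) = P M * (1 - P M - Q M) + Q M * (1 - P M - Q M)"
    by (simp add: Y0 algebra_simps)
  also have "\<dots> < P M * (1 - P M' - Q M') + Q M * (1 - Q M')"
    using PQ_strict by (intro add_strict_mono mult_strict_left_mono) auto
  also have "\<dots> = W" using QJ by (simp add: W_eq algebra_simps)
  finally have W_gt: "Y 0 * (1 - Y 0) < W" .
  have Y_pos: "0 < Y k" for k
    using Y_mono[of 0 k] Y0 PQ_strict by simp
  have Y_step: "Y k < Y (Suc k)" "Y (Suc k) * (1 - Y k) = W" if "k < N1" for k
    using init_back_step[of "Y 0" W k] W_gt Y_pos[of 0] Y_mono[of "Suc k" N1] that YN assms(4)
    by (auto simp: Y_def y_def W_def simp del: init_back.simps(2))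
  have "0 < W"
    using Y_step(2)[of 0] Y_pos[of "Suc 0"] Y_mono[of 0 N1] YN assms by (force simp: zero_less_mult_iff)

  \<comment> \<open>Forward indexing and verification of the equations\<close>
  define \<rho>1 where "\<rho>1 = (\<lambda>n. Y (N1 - n))"
  define \<rho>2 where "\<rho>2 = (\<lambda>m. P (M - m))"
  define R where "R = (\<lambda>m. Q (M - m))"
  \<comment> \<open>This solves (iii) for \<open>j2\<close>, so that (iv) turns into
    \<open>P_rec\<close>.\<close>
  define j2 where "j2 = (\<lambda>m. \<rho>2 m * (1 - \<rho>2 (m + 1)))"
  have reflect: "N - n = Suc (N - (n + 1))" "N - (n + 1) < N" if "n < N" for N n :: nat
    using that by auto
  have rho1: "0 < \<rho>1 n" "\<rho>1 (n + 1) < \<rho>1 n" "\<rho>1 n * (1 - \<rho>1 (n + 1)) = W" if "n < N1" for n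
    using Y_step[OF reflect(2)[OF that]] Y_pos reflect(1)[OF that] by (simp_all add: \<rho>1_def)
  have rho2: "0 < \<rho>2 m" "\<rho>2 (m + 1) < \<rho>2 m" "0 < j2 m" if "m < M" for m
  proof -
    show lt: "\<rho>2 (m + 1) < \<rho>2 m"
      using P_strict[OF reflect(2)[OF that]] reflect(1)[OF that] by (simp add: \<rho>2_def)
    show pos: "0 < \<rho>2 m"
      using lt P_nonneg[of "M - (m + 1)"] by (simp add: \<rho>2_def)
    show "0 < j2 m"
      using pos lt P_le[of "M - m"] by (simp add: j2_def \<rho>2_def)
  qed
  have R: "0 < R m" "R (m + 1) < R m" "R m * (1 - R (m + 1)) = J" if "m < N2" for m
  proof -
    have m: "m < M" "N3 \<le> M - (m + 1)" using that by (auto simp: M_def)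
    show lt: "R (m + 1) < R m"
      using Q_strict[OF m(2) reflect(2)[OF m(1)]] reflect(1)[OF m(1)] by (simp add: R_def)
    show "0 < R m"
      using lt Q_nonneg[of "M - (m + 1)"] by (simp add: R_def)
    show "R m * (1 - R (m + 1)) = J"
      using Q_rec[OF m(2) reflect(2)[OF m(1)]] reflect(1)[OF m(1)] by (simp add: R_def)
  qed
  have R_0: "R m = 0" if "N2 \<le> m" for m
    using that by (simp add: R_def M_def Q_0)
  have j2_step: "j2 (m + 1) = j2 m - R (m + 1) * \<rho>2 m - (R m - R (m + 2)) * \<rho>2 (m + 1)"
    if "m + 2 \<le> M" for m
  proof -
    define k where "k = M - (m + 2)"
    have "M - m = Suc (Suc k)" "M - (m + 1) = Suc k" "M - (m + 2) = k" "M - (m + 1 + 1) = k"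
      using that by (auto simp: k_def)
    with P_rec[of k] show ?thesis
      by (simp add: j2_def \<rho>2_def R_def algebra_simps)
  qed
  have forward: "x \<noteq> 0 \<and> z = 1 - v / x" if "0 < x" "x * (1 - z) = v" for x z v :: real
    using that by (auto simp: field_simps)
  have "stationary_solution N1 N2 N3 \<rho>0 c \<rho>1 \<rho>2 R W j2 J"
    unfolding stationary_solution_def M_def[symmetric]
  proof (intro conjI)
    show "\<forall>n<N1. \<rho>1 n \<noteq> 0 \<and> \<rho>1 (n + 1) = 1 - W / \<rho>1 n"
      using rho1 forward by blast
    show "\<forall>m<N2. R m \<noteq> 0 \<and> R (m + 1) = 1 - J / R m"
      using R forward by blast
    show "\<forall>m. N2 \<le> m \<and> m < M \<longrightarrow> R (m + 1) = R m"
      using R_0 by simp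
    show "\<forall>m<M. \<rho>2 m \<noteq> 0 \<and> \<rho>2 (m + 1) = 1 - j2 m / \<rho>2 m"
      using rho2 forward j2_def by blast
    show "\<forall>m. m + 2 \<le> M \<longrightarrow>
        j2 (m + 1) = j2 m - R (m + 1) * \<rho>2 m - (R m - R (m + 2)) * \<rho>2 (m + 1)"
      using j2_step by blast
    show "\<rho>1 0 = \<rho>0" by (simp add: \<rho>1_def YN)
    \<comment> \<open>\<open>split\<close> is equivalent to
      \<open>Q M = c * (P M + Q M)\<close>.\<close>
    show "R 0 = c * \<rho>1 N1" "\<rho>2 0 = (1 - c) * \<rho>1 N1"
      using split by (simp_all add: R_def \<rho>1_def \<rho>2_def Y0 P_def Q_def algebra_simps)
    show "W = j2 0 + J - \<rho>2 0 * R 1"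
      by (simp add: W_eq j2_def \<rho>2_def R_def M')
    show "R N2 = 0" by (simp add: R_0)
    show "\<rho>2 M = 0" by (simp add: \<rho>2_def P_def p_def)
  qed
  moreover have "0 < \<rho>1 n" for n by (simp add: \<rho>1_def Y_pos)
  moreover have "\<rho>2 0 < \<rho>1 N1" using PQ_strict by (simp add: \<rho>1_def \<rho>2_def Y0)
  moreover have "R N2 = 0" by (simp add: R_0)
  moreover have "\<rho>2 M = 0" by (simp add: \<rho>2_def P_def p_def)
  ultimately show ?thesis
    unfolding M_def[symmetric] using rho1 rho2 R \<open>0 < W\<close> J by blast
qed

end
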